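(* Let $\Gamma$ be a weighted quiver without flavor nodes whose underlying graph is a tree, with a chosen root $i_\bullet\in\Gamma_0$. Let $\Pi_\Gamma^\vee=\{\xi_\bullet,\xi_a,\xi_i,\xi_{s_{i,m}},\xi_{t_{i,m}}\mid a\in\Gamma_1,\ i\in\Gamma_0,\ 1\le m<d_i\}$, where $$\xi_{t_{i,m}}=x_{\varpi_{i,m}}+\rho(i),\qquad \xi_{s_{i,m}}=p_{\varpi_{i,m}}+x_{\varpi_{i,m}}-p_{\varpi_{i,d_i}}+\rho(i),$$ $$\xi_\bullet=\sum_{i\in\Gamma_0}x_{\varpi_{i,d_i}},\qquad \xi_i=-p_{\varpi_{i,d_i}},$$ $$\xi_{a:i\to j}=\begin{cases}\sum_{k\in\Gamma^\dagger_{\ge j}}x_{\varpi_{k,d_k}},&\mathrm{sgn}(a)=1,\\-\sum_{k\in\Gamma^\dagger_{\ge i}}x_{\varpi_{k,d_k}},&\mathrm{sgn}(a)=-1.\end{cases}$$ Then $(\Pi_\Gamma,\Pi_\Gamma^\vee)$ is a compatible pair in the lattice $\Lambda_{|\Gamma|}$.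
   Context: $\Gamma$ is a finite quiver with node set $\Gamma_0$ and arrow set $\Gamma_1$, each node $i$ carrying an integer $d_i\ge1$ (dimension of a vector space $V_i$); here all nodes are gauge nodes. **Lattice and seed.** $\Lambda_{|\Gamma|}$ is the free abelian group with basis $p_{i,m},x_{i,m}$ ($i\in\Gamma_0$, $1\le m\le d_i$), with skew form $(p_{i,m},x_{j,n})=\delta_{ij}\delta_{mn}=-(x_{j,n},p_{i,m})$ and all other pairings of basis vectors zero. Put $p_{\varpi_{i,m}}=\sum_{r=1}^mp_{i,r}$ and $x_{\varpi_{i,m}}=\sum_{r=1}^mx_{i,r}$. The seed $\Pi_\Gamma$ consists of the vectors $e_{s_{i,m}}=x_{i,m+1}-x_{i,m}$ and $e_{t_{i,m}}=p_{i,m}-p_{i,m+1}+x_{i,m}-x_{i,m+1}$ for $i\in\Gamma_0$, $1\le m<d_i$, and $e_a=p_{j,d_j}-p_{i,1}$ for each arrow $a\colon i\to j$. **Tree notation.** $\Gamma^\dagger=(\Gamma,i_\bullet)$ is the rooted tree. $\Gamma^\dagger_{>i}$ is the set of all descendants of $i$, and $\Gamma^\dagger_{\ge i}=\Gamma^\dagger_{>i}\cup\{i\}$. For a node $i$: $\mathrm{sgn}(i)=1$ if $i$ is the root or $i$ receives an arrow from its parent, and $\mathrm{sgn}(i)=-1$ otherwise. For an arrow $a$: $\mathrm{sgn}(a)=1$ if $a$ points from parent to child, and $-1$ otherwise. Define $$\rho(i)=\begin{cases}\sum_{a:i\to j}\sum_{k\in\Gamma^\dagger_{\ge j}}x_{\varpi_{k,d_k}},&\mathrm{sgn}(i)=1,\\-x_{\varpi_{i,d_i}}-\sum_{a:j\to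 i}\sum_{k\in\Gamma^\dagger_{\ge j}}x_{\varpi_{k,d_k}},&\mathrm{sgn}(i)=-1.\end{cases}$$ **Compatible pair.** A cluster seed in a lattice $\Lambda$ is a finite subset extendable to a $\mathbb Z$-basis of $\Lambda$. A compatible pair in $\Lambda$ of rank $d$ is a pair $(\Pi,\Pi^\vee)$ with $\Pi$ a cluster seed and $\Pi^\vee=\{\xi_j\}_{j=1}^d$ an ordered $\mathbb Z$-basis of $\Lambda$ for which there is an ordering $\Pi=\{e_i\}_{i=1}^r$ with $(e_i,\xi_j)=\delta_{ij}$ for $1\le i\le r$, $1\le j\le d$. Here the correspondence is $e_{s_{i,m}}\leftrightarrow\xi_{s_{i,m}}$, $e_{t_{i,m}}\leftrightarrow\xi_{t_{i,m}}$, $e_a\leftrightarrow\xi_a$, while $\xi_i$ ($i\in\Gamma_0$) and $\xi_\bullet$ are frozen (paired to zero with every element of $\Pi_\Gamma$). *)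

theory Defs
  imports "HOL-Algebra.Free_Abelian_Groups" "Graph_Theory.Graph_Theory"
begin

section \<open>Lattices and compatible pairs\<close>

global_interpretation frag: Modules.module "frag_cmul :: int \<Rightarrow> ('b \<Rightarrow>\<^sub>0 int) \<Rightarrow> ('b \<Rightarrow>\<^sub>0 int)"
  by standard (simp_all add: frag_cmul_distrib frag_cmul_distrib2)

definition Z_basis :: "('b \<Rightarrow>\<^sub>0 int) set \<Rightarrow> ('b \<Rightarrow>\<^sub>0 int) set \<Rightarrow> bool" where
  "Z_basis L B \<longleftrightarrow> frag.independent B \<and> frag.span B = L"

definition ordered_Z_basis :: "('b \<Rightarrow>\<^sub>0 int) set \<Rightarrow> ('b \<Rightarrow>\<^sub>0 int) list \<Rightarrow> bool" where
  "ordered_Z_basis L xs \<longleftrightarrow> distinct xs \<and> Z_basis L (set xs)"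

definition cluster_seed :: "('b \<Rightarrow>\<^sub>0 int) set \<Rightarrow> ('b \<Rightarrow>\<^sub>0 int) set \<Rightarrow> bool" where
  "cluster_seed L E \<longleftrightarrow> finite E \<and> (\<exists>B. E \<subseteq> B \<and> Z_basis L B)"

definition dual_orderings ::
    "(('b \<Rightarrow>\<^sub>0 int) \<Rightarrow> ('b \<Rightarrow>\<^sub>0 int) \<Rightarrow> int) \<Rightarrow> ('b \<Rightarrow>\<^sub>0 int) list \<Rightarrow> ('b \<Rightarrow>\<^sub>0 int) list \<Rightarrow> bool" where
  "dual_orderings \<omega> es xs \<longleftrightarrow>
     (\<forall>i<length es. \<forall>j<length xs. \<omega> (es ! i) (xs ! j) = (if i = j then 1 else 0))"

text \<open>The lattice is given by its underlying set \<open>L\<close> and its skew form \<open>\<omega>\<close>.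
  The first component \<open>E\<close> is a set, the second one an ordered basis.\<close>

definition compatible_pair ::
    "('b \<Rightarrow>\<^sub>0 int) set \<Rightarrow> (('b \<Rightarrow>\<^sub>0 int) \<Rightarrow> ('b \<Rightarrow>\<^sub>0 int) \<Rightarrow> int)
      \<Rightarrow> ('b \<Rightarrow>\<^sub>0 int) set \<Rightarrow> ('b \<Rightarrow>\<^sub>0 int) list \<Rightarrow> bool" where
  "compatible_pair L \<omega> E xs \<longleftrightarrow>
     cluster_seed L E \<and> ordered_Z_basis L xs \<and>
     (\<exists>es. distinct es \<and> set es = E \<and> dual_orderings \<omega> es xs)"


section \<open>The lattice of a weighted quiver\<close>

text \<open>A quiver is a \<open>pre_digraph\<close> (multiple arrows and loops are permitted); the weights are given
  by a function \<open>d\<close> on the nodes.\<close>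

datatype 'v gen = P 'v nat | X 'v nat

definition gens :: "('v,'a) pre_digraph \<Rightarrow> ('v \<Rightarrow> nat) \<Rightarrow> 'v gen set" where
  "gens G d = {P i m | i m. i \<in> verts G \<and> 1 \<le> m \<and> m \<le> d i}
            \<union> {X i m | i m. i \<in> verts G \<and> 1 \<le> m \<and> m \<le> d i}"

definition quiver_lattice :: "('v,'a) pre_digraph \<Rightarrow> ('v \<Rightarrow> nat) \<Rightarrow> ('v gen \<Rightarrow>\<^sub>0 int) set" where
  "quiver_lattice G d = carrier (free_Abelian_group (gens G d))"

fun gen_pairing :: "'v gen \<Rightarrow> 'v gen \<Rightarrow> int" where
  "gen_pairing (P i m) (X j n) = (if i = j \<and> m = n then 1 else 0)"
| "gen_pairing (X j n) (P i m) = (if i = j \<and> m = n then -1 else 0)"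
| "gen_pairing (P _ _) (P _ _) = 0"
| "gen_pairing (X _ _) (X _ _) = 0"

text \<open>The bilinear extension of \<open>gen_pairing\<close>.\<close>

definition skew_form :: "('v gen \<Rightarrow>\<^sub>0 int) \<Rightarrow> ('v gen \<Rightarrow>\<^sub>0 int) \<Rightarrow> int" where
  "skew_form u v = (\<Sum>a\<in>Poly_Mapping.keys u. \<Sum>b\<in>Poly_Mapping.keys v.
      Poly_Mapping.lookup u a * Poly_Mapping.lookup v b * gen_pairing a b)"

lemma skew_form_frag_of [simp]: "skew_form (frag_of a) (frag_of b) = gen_pairing a b"
  by (simp add: skew_form_def)

lemma gen_pairing_skew: "gen_pairing a b = - gen_pairing b a"
  by (cases a; cases b) auto

lemma skew_form_skew: "skew_form u v = - skew_form v u"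
proof -
  have "skew_form v u = (\<Sum>a\<in>Poly_Mapping.keys u. \<Sum>b\<in>Poly_Mapping.keys v.
      Poly_Mapping.lookup v b * Poly_Mapping.lookup u a * gen_pairing b a)"
    unfolding skew_form_def by (rule sum.swap)
  also have "\<dots> = (\<Sum>a\<in>Poly_Mapping.keys u. \<Sum>b\<in>Poly_Mapping.keys v.
      - (Poly_Mapping.lookup u a * Poly_Mapping.lookup v b * gen_pairing a b))"
    by (intro sum.cong refl) (subst gen_pairing_skew, simp)
  finally show ?thesis
    by (simp add: skew_form_def sum_negf)
qed

lemma skew_form_superset:
  assumes "finite A" "finite B" "Poly_Mapping.keys u \<subseteq> A" "Poly_Mapping.keys v \<subseteq> B"
  shows "skew_form u v = (\<Sum>a\<in>A. \<Sum>b\<in>B.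
    Poly_Mapping.lookup u a * Poly_Mapping.lookup v b * gen_pairing a b)"
proof -
  have "skew_form u v = (\<Sum>a\<in>Poly_Mapping.keys u. \<Sum>b\<in>B.
      Poly_Mapping.lookup u a * Poly_Mapping.lookup v b * gen_pairing a b)"
    unfolding skew_form_def
    by (intro sum.cong refl sum.mono_neutral_left assms) (auto simp: in_keys_iff)
  also have "\<dots> = (\<Sum>a\<in>A. \<Sum>b\<in>B.
      Poly_Mapping.lookup u a * Poly_Mapping.lookup v b * gen_pairing a b)"
    by (intro sum.mono_neutral_left assms) (auto simp: in_keys_iff)
  finally show ?thesis .
qed

lemma skew_form_add_left: "skew_form (u + u') v = skew_form u v + skew_form u' v"
proof -
  let ?A = "Poly_Mapping.keys u \<union> Poly_Mapping.keys u'"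
  have *: "skew_form w v = (\<Sum>a\<in>?A. \<Sum>b\<in>Poly_Mapping.keys v.
      Poly_Mapping.lookup w a * Poly_Mapping.lookup v b * gen_pairing a b)"
    if "Poly_Mapping.keys w \<subseteq> ?A" for w
    using that by (intro skew_form_superset) auto
  show ?thesis
    by (subst (1 2 3) *) (auto simp: keys_add lookup_add algebra_simps sum.distrib
        dest: subsetD[OF keys_add])
qed

lemma skew_form_add_right: "skew_form v (u + u') = skew_form v u + skew_form v u'"
  using skew_form_add_left[of u u' v] skew_form_skew[of v] by simp

definition p_gen :: "'v \<Rightarrow> nat \<Rightarrow> ('v gen \<Rightarrow>\<^sub>0 int)" where
  "p_gen i m = frag_of (P i m)"

definition x_gen :: "'v \<Rightarrow> nat \<Rightarrow> ('v gen \<Rightarrow>\<^sub>0 int)" where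
  "x_gen i m = frag_of (X i m)"

definition p_varpi :: "'v \<Rightarrow> nat \<Rightarrow> ('v gen \<Rightarrow>\<^sub>0 int)" where
  "p_varpi i m = (\<Sum>r=1..m. p_gen i r)"

definition x_varpi :: "'v \<Rightarrow> nat \<Rightarrow> ('v gen \<Rightarrow>\<^sub>0 int)" where
  "x_varpi i m = (\<Sum>r=1..m. x_gen i r)"


section \<open>The seed\<close>

datatype ('v,'a) mutable_label = S 'v nat | T 'v nat | A 'a

definition mutable_labels :: "('v,'a) pre_digraph \<Rightarrow> ('v \<Rightarrow> nat) \<Rightarrow> ('v,'a) mutable_label set" where
  "mutable_labels G d = {S i m | i m. i \<in> verts G \<and> 1 \<le> m \<and> m < d i}
                      \<union> {T i m | i m. i \<in> verts G \<and> 1 \<le> m \<and> m < d i}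
                      \<union> A ` arcs G"

fun seed_vector ::
    "('v,'a) pre_digraph \<Rightarrow> ('v \<Rightarrow> nat) \<Rightarrow> ('v,'a) mutable_label \<Rightarrow> ('v gen \<Rightarrow>\<^sub>0 int)" where
  "seed_vector G d (S i m) = x_gen i (m + 1) - x_gen i m"
| "seed_vector G d (T i m) = p_gen i m - p_gen i (m + 1) + x_gen i m - x_gen i (m + 1)"
| "seed_vector G d (A a) = p_gen (head G a) (d (head G a)) - p_gen (tail G a) 1"

definition quiver_seed :: "('v,'a) pre_digraph \<Rightarrow> ('v \<Rightarrow> nat) \<Rightarrow> ('v gen \<Rightarrow>\<^sub>0 int) set" where
  "quiver_seed G d = seed_vector G d ` mutable_labels G d"


section \<open>Rooted trees\<close>

text \<open>Undirected walks in \<open>G\<close> are directed walks in the digraph in which every arrow \<open>a\<close> can be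
  traversed forwards, as \<open>(a, True)\<close>, and backwards, as \<open>(a, False)\<close>.\<close>

definition two_way :: "('v,'a) pre_digraph \<Rightarrow> ('v, 'a \<times> bool) pre_digraph" where
  "two_way G = \<lparr> verts = verts G, arcs = arcs G \<times> UNIV,
     tail = (\<lambda>(a, b). if b then tail G a else head G a),
     head = (\<lambda>(a, b). if b then head G a else tail G a) \<rparr>"

text \<open>The underlying graph is a multigraph, in which a loop is a cycle of length 1 and two parallel or
  antiparallel arrows form a cycle of length 2. Distinctness of the underlying arrows excludes
  going back and forth along one edge. (The predicate \<open>tree\<close> of Graph\_Theory only forbids
  \<^emph>\<open>directed\<close> cycles, so it does not express this.)\<close>

definition underlying_tree :: "('v,'a) pre_digraph \<Rightarrow> bool" where
  "underlying_tree G \<longleftrightarrow> Digraph_Component.connected G \<and>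
     \<not> (\<exists>c. pre_digraph.cycle (two_way G) c \<and> distinct (map fst c))"

text \<open>Pairs (parent, child): the parent of \<open>j\<close> is the last but one node on the simple path from
  the root \<open>r\<close> to \<open>j\<close>.\<close>

definition parent_rel :: "('v,'a) pre_digraph \<Rightarrow> 'v \<Rightarrow> ('v \<times> 'v) set" where
  "parent_rel G r = {(i, j). \<exists>w e. pre_digraph.apath (two_way G) r (w @ [e]) j \<and>
     tail (two_way G) e = i}"

definition descendants :: "('v,'a) pre_digraph \<Rightarrow> 'v \<Rightarrow> 'v \<Rightarrow> 'v set" where
  "descendants G r i = {j. (i, j) \<in> (parent_rel G r)\<^sup>+}"

definition descendants_eq :: "('v,'a) pre_digraph \<Rightarrow> 'v \<Rightarrow> 'v \<Rightarrow> 'v set" where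
  "descendants_eq G r i = descendants G r i \<union> {i}"

definition node_sgn :: "('v,'a) pre_digraph \<Rightarrow> 'v \<Rightarrow> 'v \<Rightarrow> int" where
  "node_sgn G r i =
     (if i = r \<or> (\<exists>a\<in>arcs G. head G a = i \<and> (tail G a, i) \<in> parent_rel G r) then 1 else -1)"

definition arrow_sgn :: "('v,'a) pre_digraph \<Rightarrow> 'v \<Rightarrow> 'a \<Rightarrow> int" where
  "arrow_sgn G r a = (if (tail G a, head G a) \<in> parent_rel G r then 1 else -1)"


section \<open>The dual basis\<close>

definition subtree_sum ::
    "('v,'a) pre_digraph \<Rightarrow> 'v \<Rightarrow> ('v \<Rightarrow> nat) \<Rightarrow> 'v \<Rightarrow> ('v gen \<Rightarrow>\<^sub>0 int)" where
  "subtree_sum G r d j = (\<Sum>k\<in>descendants_eq G r j. x_varpi k (d k))"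

definition rho :: "('v,'a) pre_digraph \<Rightarrow> 'v \<Rightarrow> ('v \<Rightarrow> nat) \<Rightarrow> 'v \<Rightarrow> ('v gen \<Rightarrow>\<^sub>0 int)" where
  "rho G r d i =
     (if node_sgn G r i = 1
      then (\<Sum>a\<in>{a \<in> arcs G. tail G a = i}. subtree_sum G r d (head G a))
      else - x_varpi i (d i) - (\<Sum>a\<in>{a \<in> arcs G. head G a = i}. subtree_sum G r d (tail G a)))"

fun dual_vector ::
    "('v,'a) pre_digraph \<Rightarrow> 'v \<Rightarrow> ('v \<Rightarrow> nat) \<Rightarrow> ('v,'a) mutable_label \<Rightarrow> ('v gen \<Rightarrow>\<^sub>0 int)" where
  "dual_vector G r d (S i m) = p_varpi i m + x_varpi i m - p_varpi i (d i) + rho G r d i"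
| "dual_vector G r d (T i m) = x_varpi i m + rho G r d i"
| "dual_vector G r d (A a) =
     (if arrow_sgn G r a = 1 then subtree_sum G r d (head G a) else - subtree_sum G r d (tail G a))"

datatype 'v frozen_label = Node 'v | Bullet

definition frozen_labels :: "('v,'a) pre_digraph \<Rightarrow> 'v frozen_label set" where
  "frozen_labels G = insert Bullet (Node ` verts G)"

fun frozen_vector ::
    "('v,'a) pre_digraph \<Rightarrow> ('v \<Rightarrow> nat) \<Rightarrow> 'v frozen_label \<Rightarrow> ('v gen \<Rightarrow>\<^sub>0 int)" where
  "frozen_vector G d (Node i) = - p_varpi i (d i)"
| "frozen_vector G d Bullet = (\<Sum>i\<in>verts G. x_varpi i (d i))"

end

theory Submission
  imports Defs
begin

text \<open>
  Complete the seed by the vectors \<open>x\<^bsub>i,1\<^esub>\<close>, one for every node \<open>i\<close>, and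
  \<open>p\<^bsub>r,1\<^esub>\<close> for the root \<open>r\<close>, matching them with the frozen vectors \<open>\<xi>\<^sub>i\<close> and \<open>\<xi>\<^sub>\<bullet>\<close>. Then the matrix of
  pairings between the completed seed and the proposed dual basis is unitriangular if the mutable
  labels are put before the frozen ones: a mutable seed vector pairs to a Kronecker delta with
  everything, a completing vector does so at least with the frozen vectors. Everything else is
  a consequence of this.

  A unitriangular pairing makes both families linearly independent
  (\<open>unitriangular_independent\<close>). The completed seed generates the lattice because the tree is
  connected (\<open>full_seed_span\<close>): the differences \<open>x\<^bsub>i,m+1\<^esub> - x\<^bsub>i,m\<^esub>\<close> and \<open>x\<^bsub>i,1\<^esub>\<close> give all \<open>x\<^bsub>i,m\<^esub>\<close>, then
  the remaining seed vectors give the differences of the \<open>p\<^bsub>i,m\<^esub>\<close> at each node and across each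
  arrow, so that \<open>p\<^bsub>r,1\<^esub>\<close> propagates along walks to all \<open>p\<^bsub>i,m\<^esub>\<close>. So the completed seed
  is a basis. The form is nondegenerate on the lattice, and by Gaussian elimination a
  family that pairs unitriangularly with a basis generates too (\<open>unitriangular_span\<close>); hence
  the dual vectors are a basis as well, without any count of ranks.

  It remains to compute the pairings. Those with \<open>e\<^bsub>s,i,m\<^esub>\<close> and \<open>e\<^bsub>t,i,m\<^esub>\<close> only look at two
  neighbouring coordinates at one node. The arrow vector \<open>e\<^sub>a\<close> pairs with \<open>x\<^bsub>\<varpi>,k,d k\<^esub>\<close> to \<open>1\<close> if \<open>k\<close> is
  the head of \<open>a\<close> only, to \<open>-1\<close> if \<open>k\<close> is the tail only. So its pairing with the sum over the
  subtree below \<open>c\<close> says whether \<open>a\<close> crosses the boundary of this subtree, and in which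
  direction; but in a tree the only crossing arrow is the one that joins \<open>c\<close> to its parent
  (\<open>child_end_in_subtree\<close>, \<open>parent_end_notin_subtree\<close>). This gives
  \<open>(e\<^sub>a, \<xi>\<^sub>b) = \<delta>\<^bsub>a,b\<^esub>\<close> (\<open>arrow_pairing\<close>). Finally \<open>\<rho>(i)\<close> is a sum of vectors \<open>\<xi>\<^sub>b\<close>, up to a
  correction term for negative nodes (\<open>rho_eq\<close>), which yields \<open>(e\<^sub>a, \<rho>(i)) = 1\<close> exactly if \<open>i\<close> is the
  tail of \<open>a\<close>; this cancels the pairing of \<open>e\<^sub>a\<close> with \<open>x\<^bsub>\<varpi>,i,m\<^esub>\<close> for \<open>1 \<le> m < d i\<close>.
\<close>


section \<open>Unitriangular pairings\<close>

lemma module_int: "module ((*) :: int \<Rightarrow> int \<Rightarrow> int)"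
  by unfold_locales (simp_all add: algebra_simps)

lemma frag_hom_iff:
  "module_hom frag_cmul (*) f \<longleftrightarrow>
    (\<forall>u v. f (u + v) = f u + f v) \<and> (\<forall>c u. f (frag_cmul c u) = c * f u)"
  using module_int frag.module_axioms
  by (auto simp: module_hom_def module_hom_axioms_def)

text \<open>Applied to a vanishing linear combination, the functional \<open>\<phi> i\<close> isolates the coefficient of
  \<open>f i\<close> once the coefficients of smaller rank are known to be zero. Ranks, rather than a linear
  order on the labels, allow whole blocks of labels to be treated at once.\<close>

lemma
  fixes f :: "'l \<Rightarrow> 'b \<Rightarrow>\<^sub>0 int" and \<phi> :: "'l \<Rightarrow> ('b \<Rightarrow>\<^sub>0 int) \<Rightarrow> int" and rank :: "'l \<Rightarrow> nat"
  assumes hom: "\<And>i. module_hom frag_cmul (*) (\<phi> i)"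
    and tri: "\<And>i j. i \<in> I \<Longrightarrow> j \<in> I \<Longrightarrow> rank i \<le> rank j \<Longrightarrow> \<phi> i (f j) = (if i = j then 1 else 0)"
  shows unitriangular_inj: "inj_on f I"
    and unitriangular_independent: "frag.independent (f ` I)"
proof -
  show inj: "inj_on f I"
  proof (rule inj_onI)
    fix i j assume "i \<in> I" "j \<in> I" "f i = f j"
    then show "i = j"
      using tri by (metis linear order_refl zero_neq_one)
  qed
  show "frag.independent (f ` I)"
    unfolding frag.independent_explicit_module
  proof (intro allI impI)
    fix t u v
    assume t: "finite t" "t \<subseteq> f ` I" and rel: "(\<Sum>v\<in>t. frag_cmul (u v) v) = 0" and "v \<in> t"
    from t obtain J where J: "J \<subseteq> I" "t = f ` J" "finite J"
      using finite_subset_image by metis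
    have inj': "inj_on f J" using inj J(1) by (rule inj_on_subset)
    have "u (f i) = 0" if "i \<in> J" for i
      using that
    proof (induction "rank i" arbitrary: i rule: less_induct)
      case less
      interpret module_hom frag_cmul "(*)" "\<phi> i" by (rule hom)
      have "0 = \<phi> i (\<Sum>j\<in>J. frag_cmul (u (f j)) (f j))"
        using rel zero unfolding J(2) by (simp add: sum.reindex[OF inj'])
      also have "\<dots> = (\<Sum>j\<in>J. u (f j) * \<phi> i (f j))"
        by (simp add: sum scale)
      also have "\<dots> = (\<Sum>j\<in>J. if i = j then u (f i) else 0)"
      proof (rule sum.cong)
        fix j assume j: "j \<in> J"
        show "u (f j) * \<phi> i (f j) = (if i = j then u (f i) else 0)"
        proof (cases "rank i \<le> rank j")
          case True
          then have "\<phi> i (f j) = (if i = j then 1 else 0)"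
            using less.prems j J(1) by (intro tri) auto
          then show ?thesis by simp
        next
          case False
          then have "u (f j) = 0" "i \<noteq> j" using less.hyps j by auto
          then show ?thesis by simp
        qed
      qed simp
      finally show ?case using less J(3) by simp
    qed
    with J \<open>v \<in> t\<close> show "u v = 0" by auto
  qed
qed

text \<open>Gaussian elimination: subtract from \<open>v\<close> combinations of the \<open>x i\<close>, rank by rank, until the rest
  pairs to zero with all \<open>e i\<close>, hence with \<open>L\<close>. No division occurs since the diagonal consists of
  ones; this is why it works over the integers.\<close>

lemma unitriangular_span:
  fixes e x :: "'l \<Rightarrow> 'b \<Rightarrow>\<^sub>0 int" and rank :: "'l \<Rightarrow> nat"
  assumes hom: "\<And>u. module_hom frag_cmul (*) (\<omega> u)" "\<And>v. module_hom frag_cmul (*) (\<lambda>u. \<omega> u v)"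
    and nondeg: "\<And>v. v \<in> L \<Longrightarrow> (\<And>u. u \<in> L \<Longrightarrow> \<omega> u v = 0) \<Longrightarrow> v = 0"
    and fin: "finite I"
    and L: "frag.span (e ` I) = L" and x: "x ` I \<subseteq> L"
    and tri: "\<And>i j. i \<in> I \<Longrightarrow> j \<in> I \<Longrightarrow> rank i \<le> rank j \<Longrightarrow> \<omega> (e i) (x j) = (if i = j then 1 else 0)"
  shows "frag.span (x ` I) = L"
proof
  have sub: "frag.subspace L" using L frag.subspace_span by metis
  then show le: "frag.span (x ` I) \<subseteq> L" using x frag.span_minimal by blast
  show "L \<subseteq> frag.span (x ` I)"
  proof
    fix v assume v: "v \<in> L"
    have approx: "\<exists>w\<in>frag.span (x ` I). \<forall>i\<in>I. rank i < n \<longrightarrow> \<omega> (e i) (v - w) = 0" for n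
    proof (induction n)
      case 0
      show ?case using frag.span_zero by auto
    next
      case (Suc n)
      then obtain w where w: "w \<in> frag.span (x ` I)" "\<And>i. i \<in> I \<Longrightarrow> rank i < n \<Longrightarrow> \<omega> (e i) (v - w) = 0"
        by blast
      \<comment> \<open>Correcting at rank \<open>n\<close> does not disturb the pairings of smaller rank.\<close>
      let ?J = "{j \<in> I. rank j = n}"
      let ?c = "\<Sum>j\<in>?J. frag_cmul (\<omega> (e j) (v - w)) (x j)"
      have "\<omega> (e i) (v - (w + ?c)) = 0" if i: "i \<in> I" "rank i < Suc n" for i
      proof -
        interpret module_hom frag_cmul "(*)" "\<omega> (e i)" by (rule hom)
        have "\<omega> (e i) ?c = (\<Sum>j\<in>?J. \<omega> (e j) (v - w) * \<omega> (e i) (x j))"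
          by (simp add: sum scale)
        also have "\<dots> = (\<Sum>j\<in>?J. if i = j then \<omega> (e i) (v - w) else 0)"
          using i tri by (intro sum.cong) auto
        also have "\<dots> = (if rank i = n then \<omega> (e i) (v - w) else 0)"
          using i fin by simp
        also have "\<dots> = \<omega> (e i) (v - w)"
          using i w(2) by auto
        finally show ?thesis by (simp add: diff add)
      qed
      moreover have "w + ?c \<in> frag.span (x ` I)"
        using w(1)
        by (rule frag.span_add[OF _ frag.span_sum[OF frag.span_scale[OF frag.span_base]]]) auto
      ultimately show ?case by blast
    qed
    obtain n where n: "\<And>i. i \<in> I \<Longrightarrow> rank i < n"
      using finite_nat_set_iff_bounded[of "rank ` I"] fin by auto
    from approx[of n] obtain w where w: "w \<in> frag.span (x ` I)" "\<And>i. i \<in> I \<Longrightarrow> \<omega> (e i) (v - w) = 0"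
      using n by blast
    have "v - w = 0"
    proof (rule nondeg)
      show "v - w \<in> L" using v w le sub by (auto intro: frag.subspace_diff)
      fix u assume "u \<in> L"
      then have "u \<in> frag.span (e ` I)" using L by simp
      then show "\<omega> u (v - w) = 0"
      proof (induction rule: frag.span_induct_alt)
        case base
        show ?case using module_hom.zero[OF hom(2)] .
      next
        case (step c y z)
        then show ?case
          using w(2) module_hom.add[OF hom(2)] module_hom.scale[OF hom(2)] by auto
      qed
    qed
    with w show "v \<in> frag.span (x ` I)" by simp
  qed
qed

section \<open>The skew form in coordinates\<close>

lemma skew_form_frag_cmul_left: "skew_form (frag_cmul c u) v = c * skew_form u v"
proof -
  have "skew_form (frag_cmul c u) v = (\<Sum>a\<in>Poly_Mapping.keys u. \<Sum>b\<in>Poly_Mapping.keys v.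
      Poly_Mapping.lookup (frag_cmul c u) a * Poly_Mapping.lookup v b * gen_pairing a b)"
    by (intro skew_form_superset) (auto simp: keys_cmul)
  then show ?thesis
    by (simp add: skew_form_def sum_distrib_left mult.assoc)
qed

lemma skew_form_hom_left: "module_hom frag_cmul (*) (\<lambda>u. skew_form u v)"
  by (simp add: frag_hom_iff skew_form_add_left skew_form_frag_cmul_left)

lemma skew_form_hom_right: "module_hom frag_cmul (*) (skew_form u)"
  by (simp add: frag_hom_iff skew_form_add_right)
     (metis skew_form_frag_cmul_left skew_form_skew mult_minus_right)

lemmas skew_form_simps [simp] =
  module_hom.zero [OF skew_form_hom_left] module_hom.zero [OF skew_form_hom_right]
  module_hom.neg [OF skew_form_hom_left] module_hom.neg [OF skew_form_hom_right]
  module_hom.diff [OF skew_form_hom_left] module_hom.diff [OF skew_form_hom_right]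
  skew_form_add_left skew_form_add_right

text \<open>Pairing with a generator reads off a coordinate. With these rules every pairing below
  becomes a computation of coordinates of the second argument.\<close>

lemma skew_form_gen:
  shows skew_form_p_gen [simp]: "skew_form (p_gen i m) v = Poly_Mapping.lookup v (X i m)"
    and skew_form_x_gen [simp]: "skew_form (x_gen i m) v = - Poly_Mapping.lookup v (P i m)"
proof -
  have P: "gen_pairing (P i m) b = (if b = X i m then 1 else 0)"
    and X: "gen_pairing (X i m) b = (if b = P i m then - 1 else 0)" for b :: "'a gen"
    by (cases b; auto)+
  show "skew_form (p_gen i m) v = Poly_Mapping.lookup v (X i m)"
    by (simp add: skew_form_def p_gen_def P in_keys_iff if_distrib[where f = "(*) _"] cong: if_cong)
  show "skew_form (x_gen i m) v = - Poly_Mapping.lookup v (P i m)"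
    by (simp add: skew_form_def x_gen_def X in_keys_iff if_distrib[where f = "(*) _"] cong: if_cong)
qed

lemma quiver_lattice_iff: "v \<in> quiver_lattice G d \<longleftrightarrow> Poly_Mapping.keys v \<subseteq> gens G d"
  by (simp add: quiver_lattice_def free_Abelian_group_def)

lemma quiver_lattice_span: "quiver_lattice G d = frag.span (frag_of ` gens G d)"
proof
  show "quiver_lattice G d \<subseteq> frag.span (frag_of ` gens G d)"
  proof
    fix v assume "v \<in> quiver_lattice G d"
    then have "(\<Sum>i\<in>Poly_Mapping.keys v. frag_cmul (Poly_Mapping.lookup v i) (frag_of i))
        \<in> frag.span (frag_of ` gens G d)"
      by (intro frag.span_sum frag.span_scale frag.span_base) (auto simp: quiver_lattice_iff)
    then show "v \<in> frag.span (frag_of ` gens G d)"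
      using frag_expansion[of v] by (simp add: frag_extend_def comp_def)
  qed
  have "frag.subspace (quiver_lattice G d)"
    using keys_add by (fastforce simp: frag.subspace_def quiver_lattice_iff)
  then show "frag.span (frag_of ` gens G d) \<subseteq> quiver_lattice G d"
    by (intro frag.span_minimal) (auto simp: quiver_lattice_iff)
qed

lemma skew_form_nondegenerate:
  assumes v: "v \<in> quiver_lattice G d" and "\<And>u. u \<in> quiver_lattice G d \<Longrightarrow> skew_form u v = 0"
  shows "v = 0"
proof (rule poly_mapping_eqI)
  fix g
  show "Poly_Mapping.lookup v g = Poly_Mapping.lookup 0 g"
  proof (cases "g \<in> gens G d")
    case True
    then consider i m where "g = P i m" "x_gen i m \<in> quiver_lattice G d"
      | i m where "g = X i m" "p_gen i m \<in> quiver_lattice G d"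
      by (auto simp: quiver_lattice_iff gens_def x_gen_def p_gen_def)
    then show ?thesis
      using assms(2) by cases force+
  next
    case False
    then show ?thesis using v by (auto simp: quiver_lattice_iff in_keys_iff)
  qed
qed

lemma lookup_p_gen [simp]:
  "Poly_Mapping.lookup (p_gen i m) (P j n) = (if i = j \<and> m = n then 1 else 0)"
  "Poly_Mapping.lookup (p_gen i m) (X j n) = 0"
  by (auto simp: p_gen_def)

lemma lookup_x_gen [simp]:
  "Poly_Mapping.lookup (x_gen i m) (X j n) = (if i = j \<and> m = n then 1 else 0)"
  "Poly_Mapping.lookup (x_gen i m) (P j n) = 0"
  by (auto simp: x_gen_def)

lemma lookup_p_varpi [simp]:
  "Poly_Mapping.lookup (p_varpi i m) (P j n) = (if i = j \<and> 1 \<le> n \<and> n \<le> m then 1 else 0)"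
  "Poly_Mapping.lookup (p_varpi i m) (X j n) = 0"
  by (auto simp: p_varpi_def lookup_sum)

lemma lookup_x_varpi [simp]:
  "Poly_Mapping.lookup (x_varpi i m) (X j n) = (if i = j \<and> 1 \<le> n \<and> n \<le> m then 1 else 0)"
  "Poly_Mapping.lookup (x_varpi i m) (P j n) = 0"
  by (auto simp: x_varpi_def lookup_sum)

lemma lookup_sum_x_varpi:
  assumes "finite D"
  shows "Poly_Mapping.lookup (\<Sum>k\<in>D. x_varpi k (d k)) (X i m) =
      (if i \<in> D \<and> 1 \<le> m \<and> m \<le> d i then 1 else 0)"
    and "Poly_Mapping.lookup (\<Sum>k\<in>D. x_varpi k (d k)) (P i m) = 0"
proof -
  have "Poly_Mapping.lookup (\<Sum>k\<in>D. x_varpi k (d k)) (X i m) =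
      (\<Sum>k\<in>D. if k = i then if 1 \<le> m \<and> m \<le> d i then 1 else 0 else 0)"
    unfolding lookup_sum by (rule sum.cong) auto
  then show "Poly_Mapping.lookup (\<Sum>k\<in>D. x_varpi k (d k)) (X i m) =
      (if i \<in> D \<and> 1 \<le> m \<and> m \<le> d i then 1 else 0)"
    using assms by simp
qed (simp add: lookup_sum)

lemma p_varpi_in_lattice: "i \<in> verts G \<Longrightarrow> m \<le> d i \<Longrightarrow> p_varpi i m \<in> quiver_lattice G d"
  unfolding quiver_lattice_span p_varpi_def p_gen_def
  by (intro frag.span_sum frag.span_base) (auto simp: gens_def)

lemma x_varpi_in_lattice: "i \<in> verts G \<Longrightarrow> m \<le> d i \<Longrightarrow> x_varpi i m \<in> quiver_lattice G d"
  unfolding quiver_lattice_span x_varpi_def x_gen_def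
  by (intro frag.span_sum frag.span_base) (auto simp: gens_def)

lemma finite_mutable_labels:
  assumes "fin_digraph G"
  shows "finite (mutable_labels G d)"
proof -
  interpret fin_digraph G by fact
  have "mutable_labels G d \<subseteq> (\<lambda>(i, m). S i m) ` (SIGMA i:verts G. {..<d i})
      \<union> (\<lambda>(i, m). T i m) ` (SIGMA i:verts G. {..<d i}) \<union> A ` arcs G"
    by (auto simp: mutable_labels_def)
  then show ?thesis
    by (rule finite_subset) auto
qed


section \<open>Arrows and subtrees of a rooted tree\<close>

text \<open>Walks in the underlying graph are directed walks of \<open>two_way G\<close>; \<open>T\<close> qualifies notions for
  that digraph.\<close>

locale rooted_tree = fin_digraph G for G :: "('v,'a) pre_digraph" +
  fixes r :: 'v
  assumes tree: "underlying_tree G" and root: "r \<in> verts G"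
begin

sublocale T: wf_digraph "two_way G"
  by unfold_locales (auto simp: two_way_def)

abbreviation flip :: "'a \<times> bool \<Rightarrow> 'a \<times> bool" where
  "flip e \<equiv> (fst e, \<not> snd e)"

lemma verts_two_way [simp]: "verts (two_way G) = verts G"
  by (simp add: two_way_def)

lemma arcs_two_way [simp]: "e \<in> arcs (two_way G) \<longleftrightarrow> fst e \<in> arcs G"
  by (cases e) (simp add: two_way_def)

lemma ends_two_way:
  "tail (two_way G) (a, b) = (if b then tail G a else head G a)"
  "head (two_way G) (a, b) = (if b then head G a else tail G a)"
  by (simp_all add: two_way_def)

lemma ends_flip [simp]:
  "tail (two_way G) (flip e) = head (two_way G) e"
  "head (two_way G) (flip e) = tail (two_way G) e"
  by (cases e; simp add: ends_two_way)+

lemma same_arrow: "fst e = fst f \<Longrightarrow> f = e \<or> f = flip e"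
  by (cases e; cases f) auto

lemma awalk_reverse:
  "T.awalk u p v \<Longrightarrow> T.awalk v (map flip (rev p)) u"
proof (induction p arbitrary: u)
  case (Cons e p)
  then have "T.awalk v (map flip (rev p)) (head (two_way G) e)"
    and "T.awalk (head (two_way G) e) [flip e] u"
    using T.tail_in_verts[of e] by (auto simp: T.awalk_simps)
  then show ?case by simp
qed (simp add: T.awalk_simps)

lemma walk_from_root:
  assumes "v \<in> verts G"
  obtains p where "T.awalk r p v"
proof -
  from tree assms root have "r \<rightarrow>\<^sup>*\<^bsub>mk_symmetric G\<^esub> v"
    by (auto simp: underlying_tree_def connected_def strongly_connected_def)
  then have "(r, v) \<in> rtrancl_on (verts G) (parcs (mk_symmetric G))"
    by (simp add: reachable_def)
  then have "\<exists>p. T.awalk r p v"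
  proof (induction rule: rtrancl_on_induct)
    case base
    then show ?case by (auto simp: T.awalk_simps intro: exI[of _ "[]"])
  next
    case (step y z)
    then obtain p where p: "T.awalk r p y" by blast
    from step obtain a where a: "a \<in> arcs G" "(y, z) = (tail G a, head G a) \<or> (y, z) = (head G a, tail G a)"
      by (auto simp: parcs_mk_symmetric)
    then obtain b where "tail (two_way G) (a, b) = y" "head (two_way G) (a, b) = z"
      by (metis ends_two_way prod.inject)
    then have "T.awalk y [(a, b)] z"
      using a \<open>y \<in> verts G\<close> \<open>z \<in> verts G\<close> by (auto simp: T.awalk_simps)
    with p show ?case by (meson T.awalk_appendI)
  qed
  then show ?thesis using that by blast
qed

lemma path_from_root:
  assumes "v \<in> verts G"
  obtains p where "T.apath r p v"
  using walk_from_root[OF assms] T.apath_awalk_to_apath by metis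

text \<open>Using an arrow a second time, in either direction, would revisit the node from which it was first
  left.\<close>

lemma apath_distinct_arrows: "T.apath u p v \<Longrightarrow> distinct (map fst p)"
proof (induction p arbitrary: u)
  case (Cons e p)
  then have *: "T.apath (head (two_way G) e) p v" "tail (two_way G) e = u"
    "u \<notin> set (T.awalk_verts (head (two_way G) e) p)"
    by (auto simp: T.apath_Cons_iff)
  have "fst f \<noteq> fst e" if "f \<in> set p" for f
  proof
    assume "fst f = fst e"
    then have "f = e \<or> f = flip e"
      using same_arrow by metis
    then have "u = tail (two_way G) f \<or> u = head (two_way G) f"
      using * by auto
    then show False
      using that * T.awalk_verts_arc1[of f p] T.awalk_verts_arc2[of _ p v f]
      by (auto simp: T.apath_def)
  qed
  then have "fst e \<notin> fst ` set p" by (metis imageE)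
  with Cons.IH * show ?case by simp
qed simp

text \<open>A walk between the ends of an arrow that avoids the arrow shortens to a path, which the
  arrow closes to a cycle. All consequences of acyclicity below are drawn from this lemma. It also
  excludes loops, by taking the empty walk.\<close>

lemma arrow_is_bridge:
  assumes "fst e \<in> arcs G" "T.awalk (head (two_way G) e) p (tail (two_way G) e)"
  shows "fst e \<in> fst ` set p"
proof (rule ccontr)
  assume no: "fst e \<notin> fst ` set p"
  let ?q = "T.awalk_to_apath p" and ?t = "tail (two_way G) e" and ?h = "head (two_way G) e"
  have q: "T.apath ?h ?q ?t"
    using assms by (rule_tac T.apath_awalk_to_apath)
  have "set ?q \<subseteq> set p"
    using assms by (rule_tac T.awalk_to_apath_subset)
  then have "distinct (map fst (e # ?q))"
    using no apath_distinct_arrows[OF q] by auto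
  moreover have "T.awalk ?t (e # ?q) ?t"
    using q assms T.head_in_verts T.tail_in_verts by (auto simp: T.awalk_simps T.apath_def)
  then have "T.cycle (e # ?q)"
    unfolding T.cycle_def using q by (intro exI[of _ ?t]) (auto simp: T.apath_def)
  ultimately show False
    using tree by (auto simp: underlying_tree_def)
qed

lemma apath_end_visited: "T.apath u p v \<Longrightarrow> v \<in> set (T.awalk_verts u p)"
  unfolding T.apath_def using last_in_set[OF T.awalk_verts_non_Nil, of u p] by auto

lemma apath_snoc:
  "T.apath u (w @ [e]) v \<longleftrightarrow> T.apath u w (tail (two_way G) e) \<and> fst e \<in> arcs G
     \<and> head (two_way G) e = v \<and> v \<notin> set (T.awalk_verts u w)"
  (is "?L \<longleftrightarrow> ?R")
proof
  assume L: ?L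
  then have "T.awalk u w (tail (two_way G) e)" "fst e \<in> arcs G" "head (two_way G) e = v"
    by (auto simp: T.apath_def T.awalk_simps)
  then show ?R
    using L by (auto simp: T.apath_append_iff)
next
  assume R: ?R
  then have w: "T.awlast u w = tail (two_way G) e" and "tail (two_way G) e \<noteq> v"
    using apath_end_visited by (auto simp: T.apath_def)
  with R have "T.apath (tail (two_way G) e) [e] v"
    using T.head_in_verts[of e] T.tail_in_verts[of e] by (auto simp: T.apath_simps)
  with R w show ?L
    by (auto simp: T.apath_append_iff)
qed

text \<open>If two paths reached \<open>v\<close> by different arrows, then going back along the second path to the root
  and forward along the rest of the first would bypass the last arrow of the first path, which is a bridge. So
  a node has at most one parent, and is joined to it by one arrow only.\<close>

lemma last_arc_unique:
  assumes "T.apath r (w @ [e]) v" "T.apath r (w' @ [e']) v"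
  shows "e = e'"
proof (rule ccontr)
  assume ne: "e \<noteq> e'"
  note * = assms[unfolded apath_snoc]
  \<comment> \<open>No earlier arc of such a path touches \<open>v\<close>, so neither path uses the last arrow of the other.\<close>
  have avoid: "tail (two_way G) f \<noteq> v \<and> head (two_way G) f \<noteq> v"
    if "f \<in> set u" "T.apath r (u @ [g]) v" for f u g
    using that(1) apath_snoc[THEN iffD1, OF that(2)]
      T.awalk_verts_arc1[of f u r] T.awalk_verts_arc2[of r u _ f] by (auto simp: T.apath_def)
  show False
  proof (cases "fst e = fst e'")
    case True
    then have "e' = flip e" using same_arrow ne by blast
    then have "tail (two_way G) e = v" using * by auto
    then show False
      using * apath_end_visited by metis
  next
    case False
    have w: "T.awalk r w (tail (two_way G) e)" and w': "T.awalk r w' (tail (two_way G) e')"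
      using * by (auto simp: T.apath_def)
    have "T.awalk v [flip e'] (tail (two_way G) e')"
      using * T.tail_in_verts[of e'] T.head_in_verts[of e'] by (auto simp: T.awalk_simps)
    then have "T.awalk v ([flip e'] @ map flip (rev w') @ w) (tail (two_way G) e)"
      using awalk_reverse[OF w'] w by (meson T.awalk_appendI)
    then have "fst e \<in> fst ` set ([flip e'] @ map flip (rev w') @ w)"
      using * by (intro arrow_is_bridge) auto
    then obtain f where f: "f \<in> set w' \<union> set w" "fst f = fst e"
      using False by force
    then have "tail (two_way G) f = v \<or> head (two_way G) f = v"
      using same_arrow[of e f] * by auto
    then show False
      using f avoid assms by blast
  qed
qed

lemma parent_rel_iff:
  "(i, j) \<in> parent_rel G r \<longleftrightarrow> (\<exists>w e. T.apath r (w @ [e]) j \<and> tail (two_way G) e = i)"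
  by (simp add: parent_rel_def)

lemma parent_unique:
  "(i, j) \<in> parent_rel G r \<Longrightarrow> (i', j) \<in> parent_rel G r \<Longrightarrow> i = i'"
  unfolding parent_rel_iff using last_arc_unique by blast

lemma no_parent_of_root: "(i, r) \<notin> parent_rel G r"
  unfolding parent_rel_iff apath_snoc
  by (metis T.apath_def T.awhd_of_awalk T.awalk_verts_non_Nil list.set_sel(1))

lemma parent_in_verts: "(i, j) \<in> parent_rel G r \<Longrightarrow> j \<in> verts G"
  unfolding parent_rel_iff T.apath_def by (auto dest: T.awalk_last_in_verts)

text \<open>Since parents are unique, climbing from \<open>j\<close> to the root can only retrace a path from the root
  to \<open>j\<close>.\<close>

lemma ancestors_on_path:
  assumes "T.apath r p j" "(k, j) \<in> (parent_rel G r)\<^sup>+"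
  shows "k \<in> set (T.awalk_verts r p) \<and> k \<noteq> j"
  using assms
proof (induction p arbitrary: j rule: rev_induct)
  case Nil
  then show ?case
    using no_parent_of_root by (auto simp: T.apath_simps dest: tranclD2)
next
  case (snoc e p)
  let ?i = "tail (two_way G) e"
  have p: "T.apath r p ?i" and j: "j \<notin> set (T.awalk_verts r p)"
    using snoc.prems by (auto simp: apath_snoc)
  from snoc.prems(2) obtain i where i: "(k, i) \<in> (parent_rel G r)\<^sup>*" "(i, j) \<in> parent_rel G r"
    by (metis tranclD2)
  then have "i = ?i"
    using parent_unique snoc.prems(1) parent_rel_iff by blast
  then have "k = ?i \<or> k \<in> set (T.awalk_verts r p)"
    using i snoc.IH[OF p] by (metis rtranclD)
  moreover have "?i \<in> set (T.awalk_verts r p)"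
    using p by (rule apath_end_visited)
  ultimately have "k \<in> set (T.awalk_verts r p)"
    by auto
  moreover have "set (T.awalk_verts r p) \<subseteq> set (T.awalk_verts r (p @ [e]))"
    using snoc.prems(1) by (auto simp: T.awalk_verts_append T.apath_def)
  ultimately show ?case using j by auto
qed

lemma parent_acyclic: "(j, j) \<notin> (parent_rel G r)\<^sup>+"
proof
  assume j: "(j, j) \<in> (parent_rel G r)\<^sup>+"
  then have "j \<in> verts G" using parent_in_verts by (metis tranclD2)
  then show False using path_from_root ancestors_on_path j by metis
qed

text \<open>These names are justified by \<open>parent_end_child_end\<close>: a sign other than \<open>1\<close> only says that the arrow
  does not point from parent to child, and it takes an argument to see that it then points from
  child to parent.\<close>

definition parent_end :: "'a \<Rightarrow> 'v" where
  "parent_end a = (if arrow_sgn G r a = 1 then tail G a else head G a)"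

definition child_end :: "'a \<Rightarrow> 'v" where
  "child_end a = (if arrow_sgn G r a = 1 then head G a else tail G a)"

text \<open>Paths from the root to the two ends of \<open>a\<close> cannot both avoid the bridge \<open>a\<close>. A path that uses \<open>a\<close>
  and ends in an end of \<open>a\<close> must use \<open>a\<close> last, as it would otherwise visit its end point twice.\<close>

lemma last_arc_orientation:
  assumes "a \<in> arcs G"
  shows "\<exists>w b. T.apath r (w @ [(a, b)]) (head (two_way G) (a, b))"
proof -
  obtain p q where p: "T.apath r p (tail G a)" and q: "T.apath r q (head G a)"
    using assms path_from_root by (metis head_in_verts tail_in_verts)
  have "T.awalk (head G a) (map flip (rev q) @ p) (tail G a)"
    using awalk_reverse p q by (meson T.apath_def T.awalk_appendI)
  then have "a \<in> fst ` set (map flip (rev q) @ p)"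
    using arrow_is_bridge[of "(a, True)"] assms
    by (simp add: ends_two_way del: T.awalk_append_iff set_append)
  then have "a \<in> fst ` set p \<or> a \<in> fst ` set q"
    by force
  then obtain s v where s: "T.apath r s v" "a \<in> fst ` set s" and v: "v = tail G a \<or> v = head G a"
    using p q by blast
  then obtain w e where we: "s = w @ [e]"
    by (cases s rule: rev_cases) auto
  have "a \<notin> fst ` set w"
  proof
    assume "a \<in> fst ` set w"
    then obtain b where b: "(a, b) \<in> set w" by auto
    then have "v \<in> set (T.awalk_verts r w)"
      using v s(1) T.awalk_verts_arc1[OF b] T.awalk_verts_arc2[OF _ b]
      unfolding we apath_snoc T.apath_def by (cases b) (auto simp: ends_two_way)
    then show False using s(1) by (simp add: we apath_snoc)
  qed
  then have "fst e = a" using s(2) we by auto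
  then show ?thesis
    using s(1) we by (metis apath_snoc prod.collapse)
qed

lemma path_to_child_end:
  assumes "a \<in> arcs G"
  shows "\<exists>w b. T.apath r (w @ [(a, b)]) (child_end a) \<and> tail (two_way G) (a, b) = parent_end a"
proof -
  obtain w b where w: "T.apath r (w @ [(a, b)]) (head (two_way G) (a, b))"
    using last_arc_orientation assms by blast
  then have R: "(tail (two_way G) (a, b), head (two_way G) (a, b)) \<in> parent_rel G r"
    by (auto simp: parent_rel_iff)
  then have "(head (two_way G) (a, b), tail (two_way G) (a, b)) \<notin> parent_rel G r"
    using parent_acyclic by (meson trancl.intros)
  with R have "child_end a = head (two_way G) (a, b)" "parent_end a = tail (two_way G) (a, b)"
    by (cases b; simp add: child_end_def parent_end_def arrow_sgn_def ends_two_way)+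
  with w show ?thesis by metis
qed

lemma parent_end_child_end: "a \<in> arcs G \<Longrightarrow> (parent_end a, child_end a) \<in> parent_rel G r"
  using path_to_child_end parent_rel_iff by meson

lemma child_end_inj: "inj_on child_end (arcs G)"
  by (rule inj_onI) (metis path_to_child_end last_arc_unique prod.inject)

lemma descendants_eq_iff: "j \<in> descendants_eq G r i \<longleftrightarrow> (i, j) \<in> (parent_rel G r)\<^sup>*"
  by (auto simp: descendants_eq_def descendants_def rtrancl_eq_or_trancl)

lemma descendants_eq_subset: "i \<in> verts G \<Longrightarrow> descendants_eq G r i \<subseteq> verts G"
  by (auto simp: descendants_eq_def descendants_def dest: tranclD2 parent_in_verts)

lemma finite_descendants_eq: "i \<in> verts G \<Longrightarrow> finite (descendants_eq G r i)"
  using descendants_eq_subset finite_subset finite_verts by blast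

text \<open>Among all arrows, only \<open>b\<close> enters the subtree below the lower end of \<open>b\<close>: any other
  node of the subtree belongs to it together with its parent. Together with
  \<open>parent_end_notin_subtree\<close> this evaluates the pairings of arrow vectors with subtree sums.\<close>

lemma child_end_in_subtree:
  assumes "a \<in> arcs G" "b \<in> arcs G"
  shows "child_end a \<in> descendants_eq G r (child_end b) \<longleftrightarrow>
    a = b \<or> parent_end a \<in> descendants_eq G r (child_end b)"
proof
  assume L: "child_end a \<in> descendants_eq G r (child_end b)"
  show "a = b \<or> parent_end a \<in> descendants_eq G r (child_end b)"
  proof (cases "child_end a = child_end b")
    case True
    then show ?thesis using child_end_inj assms by (meson inj_onD)
  next
    case False
    then show ?thesis
      using L parent_end_child_end[OF assms(1)] parent_unique
      by (metis descendants_eq_iff rtranclE)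
  qed
next
  assume "a = b \<or> parent_end a \<in> descendants_eq G r (child_end b)"
  then show "child_end a \<in> descendants_eq G r (child_end b)"
    using parent_end_child_end[OF assms(1)] by (auto simp: descendants_eq_iff)
qed

lemma parent_end_notin_subtree:
  assumes "a \<in> arcs G"
  shows "parent_end a \<notin> descendants_eq G r (child_end a)"
  using parent_end_child_end[OF assms] parent_acyclic
  by (metis descendants_eq_iff rtrancl_into_trancl1)

text \<open>Otherwise \<open>a\<close> would join its tail to the parent, like the arrow that makes the tail
  positive; but only one arrow joins a node to its parent, and none joins the root to one.\<close>

lemma arrow_out_of_positive_node:
  assumes "node_sgn G r (tail G a) = 1" "a \<in> arcs G"
  shows "arrow_sgn G r a = 1"
proof (rule ccontr)
  assume neg: "arrow_sgn G r a \<noteq> 1"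
  then have child: "child_end a = tail G a" by (simp add: child_end_def)
  then have "tail G a \<noteq> r"
    using parent_end_child_end[OF assms(2)] no_parent_of_root by metis
  then obtain b where b: "b \<in> arcs G" "head G b = tail G a" "(tail G b, tail G a) \<in> parent_rel G r"
    using assms(1) by (auto simp: node_sgn_def split: if_splits)
  then have pos: "arrow_sgn G r b = 1" by (simp add: arrow_sgn_def)
  with b have "child_end b = child_end a" unfolding child by (simp add: child_end_def)
  then have "a = b" using inj_onD[OF child_end_inj] assms b by metis
  with pos neg show False by simp
qed

lemma arrow_into_negative_node:
  assumes "node_sgn G r (head G a) \<noteq> 1" "a \<in> arcs G"
  shows "arrow_sgn G r a \<noteq> 1"
  using assms by (auto simp: node_sgn_def arrow_sgn_def split: if_splits)

end


section \<open>Pairings of the seed with the dual vectors\<close>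

context rooted_tree
begin

lemma lookup_subtree_sum [simp]:
  assumes "c \<in> verts G"
  shows "Poly_Mapping.lookup (subtree_sum G r d c) (X i m) =
      (if i \<in> descendants_eq G r c \<and> 1 \<le> m \<and> m \<le> d i then 1 else 0)"
    and "Poly_Mapping.lookup (subtree_sum G r d c) (P i m) = 0"
  using finite_descendants_eq[OF assms]
  by (simp_all add: subtree_sum_def lookup_sum_x_varpi)

lemma dual_vector_arrow:
  "dual_vector G r d (A a) =
    (if arrow_sgn G r a = 1 then subtree_sum G r d (child_end a) else - subtree_sum G r d (child_end a))"
  by (simp add: child_end_def)


lemma child_end_in_verts: "a \<in> arcs G \<Longrightarrow> child_end a \<in> verts G"
  using parent_end_child_end parent_in_verts by blast

text \<open>The arrows in the sum defining \<open>\<rho>(i)\<close> all join \<open>i\<close> to its children, so their subtree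
  sums are, with the right sign, the dual vectors of these arrows.\<close>

lemma rho_eq:
  "rho G r d i =
    (if node_sgn G r i = 1 then \<Sum>a\<in>{a \<in> arcs G. tail G a = i}. dual_vector G r d (A a)
     else (\<Sum>a\<in>{a \<in> arcs G. head G a = i}. dual_vector G r d (A a)) - x_varpi i (d i))"
proof -
  have "(\<Sum>a\<in>{a \<in> arcs G. tail G a = i}. dual_vector G r d (A a)) =
      (\<Sum>a\<in>{a \<in> arcs G. tail G a = i}. subtree_sum G r d (head G a))" if "node_sgn G r i = 1"
    using that arrow_out_of_positive_node by (intro sum.cong) auto
  moreover have "(\<Sum>a\<in>{a \<in> arcs G. head G a = i}. dual_vector G r d (A a)) =
      - (\<Sum>a\<in>{a \<in> arcs G. head G a = i}. subtree_sum G r d (tail G a))" if "node_sgn G r i \<noteq> 1"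
    unfolding sum_negf[symmetric] using that arrow_into_negative_node by (intro sum.cong) auto
  ultimately show ?thesis
    by (simp add: rho_def del: dual_vector.simps)
qed

lemma lookup_dual_vector_arrow:
  assumes "a \<in> arcs G"
  shows "Poly_Mapping.lookup (dual_vector G r d (A a)) (X i m) =
      (if i \<in> descendants_eq G r (child_end a) \<and> 1 \<le> m \<and> m \<le> d i
       then if arrow_sgn G r a = 1 then 1 else - 1 else 0)"
    and "Poly_Mapping.lookup (dual_vector G r d (A a)) (P i m) = 0"
  using child_end_in_verts[OF assms] unfolding dual_vector_arrow by simp_all

lemma lookup_rho_P: "Poly_Mapping.lookup (rho G r d i) (P j m) = 0"
  by (simp add: rho_eq lookup_sum lookup_minus lookup_dual_vector_arrow del: dual_vector.simps)

text \<open>At each node \<open>\<rho>(i)\<close> contains a multiple of the full sum \<open>x\<^bsub>\<varpi>,j,d j\<^esub>\<close>. So \<open>e\<^bsub>t,j,m\<^esub>\<close>, which compares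
  neighbouring coordinates at \<open>j\<close>, pairs to zero with it.\<close>

lemma lookup_rho_X_const:
  assumes "1 \<le> m" "m \<le> d j" "1 \<le> n" "n \<le> d j"
  shows "Poly_Mapping.lookup (rho G r d i) (X j m) = Poly_Mapping.lookup (rho G r d i) (X j n)"
  using assms by (simp add: rho_eq lookup_sum lookup_minus lookup_dual_vector_arrow del: dual_vector.simps)

end

locale weighted_rooted_tree = rooted_tree G r for G :: "('v,'a) pre_digraph" and r +
  fixes d :: "'v \<Rightarrow> nat"
  assumes weight_pos: "i \<in> verts G \<Longrightarrow> d i \<ge> 1"
begin

text \<open>The left-hand side counts, with signs, how \<open>a\<close> crosses the boundary of the subtree that hangs on
  \<open>b\<close>.\<close>

lemma arrow_pairing:
  assumes "a \<in> arcs G" "b \<in> arcs G"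
  shows "skew_form (seed_vector G d (A a)) (dual_vector G r d (A b)) = (if a = b then 1 else 0)"
proof -
  have pos: "1 \<le> d (head G a)" "1 \<le> d (tail G a)"
    using assms weight_pos by simp_all
  have "skew_form (seed_vector G d (A a)) (dual_vector G r d (A b)) =
      (if head G a \<in> descendants_eq G r (child_end b) then if arrow_sgn G r b = 1 then 1 else - 1 else 0) -
      (if tail G a \<in> descendants_eq G r (child_end b) then if arrow_sgn G r b = 1 then 1 else - 1 else 0)"
    using pos assms by (simp add: lookup_dual_vector_arrow del: dual_vector.simps)
  also have "\<dots> = (if a = b then 1 else 0)"
  proof (cases "arrow_sgn G r a = 1")
    case True
    then have ends: "head G a = child_end a" "tail G a = parent_end a"
      by (simp_all add: child_end_def parent_end_def)
    show ?thesis
      unfolding ends using True child_end_in_subtree[OF assms] parent_end_notin_subtree[OF assms(1)] by auto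
  next
    case False
    then have ends: "head G a = parent_end a" "tail G a = child_end a"
      by (simp_all add: child_end_def parent_end_def)
    show ?thesis
      unfolding ends using False child_end_in_subtree[OF assms] parent_end_notin_subtree[OF assms(1)] by auto
  qed
  finally show ?thesis .
qed

text \<open>For a positive node \<open>i\<close> the sum of Kronecker deltas over the arrows out of \<open>i\<close> is the claim. For
  a negative node the arrows into \<open>i\<close> contribute \<open>1\<close> if \<open>i\<close> is the head of \<open>a\<close>, and the
  correction \<open>- x_varpi i (d i)\<close> trades head for tail.\<close>

lemma arrow_pairing_rho:
  assumes "a \<in> arcs G"
  shows "skew_form (seed_vector G d (A a)) (rho G r d i) = (if tail G a = i then 1 else 0)"
proof -
  note sum = module_hom.sum[OF skew_form_hom_right]
  have pos: "1 \<le> d (head G a)" "1 \<le> d (tail G a)"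
    using assms weight_pos by simp_all
  have "(\<Sum>b\<in>{b \<in> arcs G. f b = i}. skew_form (seed_vector G d (A a)) (dual_vector G r d (A b))) =
      (\<Sum>b\<in>{b \<in> arcs G. f b = i}. if a = b then 1 else 0)" for f :: "'a \<Rightarrow> 'v"
    using assms arrow_pairing by (intro sum.cong) auto
  then have *: "(\<Sum>b\<in>{b \<in> arcs G. f b = i}. skew_form (seed_vector G d (A a)) (dual_vector G r d (A b))) =
      (if f a = i then 1 else 0)" for f :: "'a \<Rightarrow> 'v"
    using assms by simp
  have "skew_form (seed_vector G d (A a)) (x_varpi i (d i)) =
      (if head G a = i then 1 else 0) - (if tail G a = i then 1 else 0)"
    using pos by auto
  with * show ?thesis
    by (simp add: rho_eq sum del: dual_vector.simps seed_vector.simps)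
qed

lemma mutable_pairing:
  assumes "k \<in> mutable_labels G d" "l \<in> mutable_labels G d"
  shows "skew_form (seed_vector G d k) (dual_vector G r d l) = (if k = l then 1 else 0)"
proof (cases k)
  case k: (A a)
  then have a: "a \<in> arcs G" using assms by (auto simp: mutable_labels_def)
  then have pos: "1 \<le> d (head G a)" "1 \<le> d (tail G a)"
    using weight_pos by simp_all
  \<comment> \<open>Since \<open>m < d i\<close>, the head coordinate \<open>d (head G a)\<close> is out of reach; the tail coordinate \<open>1\<close> is not.\<close>
  have "skew_form (seed_vector G d (A a)) (x_varpi i m) = (if tail G a = i then - 1 else 0)"
    if "1 \<le> m" "m < d i" for i m
    using that pos by auto
  moreover have "skew_form (seed_vector G d (A a)) (p_varpi i m) = 0" for i m
    by simp
  ultimately show ?thesis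
    using assms(2) arrow_pairing[OF a] arrow_pairing_rho[OF a] unfolding k
    by (auto simp: mutable_labels_def simp del: dual_vector.simps(3) seed_vector.simps split: if_splits)
next
  case k: (S i m)
  then have "1 \<le> m" "m < d i" using assms by (auto simp: mutable_labels_def)
  then show ?thesis
    using assms(2) unfolding k
    by (auto simp: mutable_labels_def lookup_add lookup_minus lookup_rho_P
        lookup_dual_vector_arrow simp del: dual_vector.simps(3) split: if_splits)
next
  case k: (T i m)
  then have m: "1 \<le> m" "m < d i" using assms by (auto simp: mutable_labels_def)
  then have "Poly_Mapping.lookup (rho G r d j) (X i m) = Poly_Mapping.lookup (rho G r d j) (X i (Suc m))" for j
    by (intro lookup_rho_X_const) auto
  with m show ?thesis
    using assms(2) unfolding k
    by (auto simp: mutable_labels_def lookup_add lookup_minus lookup_rho_P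
        lookup_dual_vector_arrow simp del: dual_vector.simps(3) split: if_splits)
qed

lemma lookup_bullet:
  "Poly_Mapping.lookup (frozen_vector G d Bullet) (X i m) = (if i \<in> verts G \<and> 1 \<le> m \<and> m \<le> d i then 1 else 0)"
  "Poly_Mapping.lookup (frozen_vector G d Bullet) (P i m) = 0"
  by (simp_all add: lookup_sum_x_varpi)

lemma frozen_pairing:
  assumes "k \<in> mutable_labels G d" "l \<in> frozen_labels G"
  shows "skew_form (seed_vector G d k) (frozen_vector G d l) = 0"
proof (cases l)
  case Bullet
  then show ?thesis
    using assms(1) weight_pos
    by (auto simp: mutable_labels_def lookup_bullet simp del: frozen_vector.simps)
next
  case (Node j)
  then show ?thesis
    using assms(1) by (auto simp: mutable_labels_def)
qed


section \<open>Completing the seed to a basis\<close>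

text \<open>Labelled by the frozen vectors to which they are dual.\<close>

fun completing_vector :: "'v frozen_label \<Rightarrow> ('v gen \<Rightarrow>\<^sub>0 int)" where
  "completing_vector (Node i) = x_gen i 1"
| "completing_vector Bullet = p_gen r 1"

lemma completing_pairing:
  assumes "k \<in> frozen_labels G" "l \<in> frozen_labels G"
  shows "skew_form (completing_vector k) (frozen_vector G d l) = (if k = l then 1 else 0)"
  using assms weight_pos root
  by (cases k; cases l)
     (auto simp: frozen_labels_def lookup_bullet simp del: frozen_vector.simps(2))

abbreviation "labels \<equiv> mutable_labels G d <+> frozen_labels G"

abbreviation "full_seed \<equiv> case_sum (seed_vector G d) completing_vector"

abbreviation "full_dual \<equiv> case_sum (dual_vector G r d) (frozen_vector G d)"

text \<open>The matrix of pairings is block triangular: a completing vector may pair to anything with a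
  mutable dual vector. So mutable labels get the smaller rank when the seed vectors act as
  functionals on the dual vectors, and the larger rank in the opposite direction.\<close>

lemma full_pairing:
  assumes "k \<in> labels" "l \<in> labels" "isl k \<or> \<not> isl l"
  shows "skew_form (full_seed k) (full_dual l) = (if k = l then 1 else 0)"
  using assms mutable_pairing frozen_pairing completing_pairing by (cases k; cases l) auto

lemma finite_labels: "finite labels"
  using finite_mutable_labels[of G d] fin_digraph_axioms
  by (auto simp: frozen_labels_def)

lemma x_gen_in_full_span:
  assumes "i \<in> verts G" "1 \<le> m" "m \<le> d i"
  shows "x_gen i m \<in> frag.span (full_seed ` labels)"
  using assms(2,3)
proof (induction m rule: dec_induct)
  case base
  have "full_seed (Inr (Node i)) \<in> frag.span (full_seed ` labels)"
    using assms(1) by (intro frag.span_base imageI) (auto simp: frozen_labels_def)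
  then show ?case by simp
next
  case (step m)
  have "full_seed (Inl (S i m)) \<in> frag.span (full_seed ` labels)"
    using assms(1) step by (intro frag.span_base imageI) (auto simp: mutable_labels_def)
  then have "full_seed (Inl (S i m)) + x_gen i m \<in> frag.span (full_seed ` labels)"
    using step by (intro frag.span_add) auto
  then show ?case by simp
qed

lemma p_gen_in_full_span_iff:
  assumes "i \<in> verts G" "1 \<le> m" "m \<le> d i"
  shows "p_gen i m \<in> frag.span (full_seed ` labels) \<longleftrightarrow> p_gen i 1 \<in> frag.span (full_seed ` labels)"
  using assms(2,3)
proof (induction m rule: dec_induct)
  case (step m)
  have "full_seed (Inl (T i m)) \<in> frag.span (full_seed ` labels)"
    using assms(1) step by (intro frag.span_base imageI) (auto simp: mutable_labels_def)
  then have "full_seed (Inl (T i m)) + (x_gen i (m + 1) - x_gen i m) \<in> frag.span (full_seed ` labels)"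
    using step assms(1) by (intro frag.span_add frag.span_diff x_gen_in_full_span) auto
  then have diff: "p_gen i m - p_gen i (Suc m) \<in> frag.span (full_seed ` labels)"
    by simp
  then have "p_gen i (Suc m) \<in> frag.span (full_seed ` labels) \<longleftrightarrow> p_gen i m \<in> frag.span (full_seed ` labels)"
    using frag.span_add_eq[OF diff, of "p_gen i (Suc m)"] by simp
  with step show ?case by simp
qed simp

text \<open>Modulo the span, \<open>p\<^bsub>j,d j\<^esub>\<close> and \<open>p\<^bsub>i,1\<^esub>\<close> agree for an arrow from \<open>i\<close> to \<open>j\<close>, and all
  \<open>p\<^bsub>i,m\<^esub>\<close> at one node agree; so membership passes along an arrow in either direction.\<close>

lemma p_gen_along_walk:
  assumes "T.awalk u q v" "p_gen u 1 \<in> frag.span (full_seed ` labels)"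
  shows "p_gen v 1 \<in> frag.span (full_seed ` labels)"
  using assms
proof (induction q arbitrary: u)
  case Nil
  then show ?case by (simp add: T.awalk_simps)
next
  case (Cons e q)
  obtain a b where e: "e = (a, b)" by (cases e)
  have a: "a \<in> arcs G" and u: "tail (two_way G) (a, b) = u" and q: "T.awalk (head (two_way G) (a, b)) q v"
    using Cons.prems(1) by (auto simp: T.awalk_simps e)
  have "full_seed (Inl (A a)) \<in> frag.span (full_seed ` labels)"
    using a by (intro frag.span_base imageI) (auto simp: mutable_labels_def)
  then have "p_gen (head G a) (d (head G a)) - p_gen (tail G a) 1 \<in> frag.span (full_seed ` labels)"
    by simp
  from frag.span_add_eq[OF this, of "p_gen (tail G a) 1"]
  have "p_gen (head G a) 1 \<in> frag.span (full_seed ` labels) \<longleftrightarrow> p_gen (tail G a) 1 \<in> frag.span (full_seed ` labels)"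
    using p_gen_in_full_span_iff[of "head G a" "d (head G a)"] a weight_pos by simp
  then have "p_gen (head (two_way G) (a, b)) 1 \<in> frag.span (full_seed ` labels)"
    using Cons.prems(2) u by (auto simp: ends_two_way split: if_splits)
  then show ?case using Cons.IH q by blast
qed

lemma full_seed_span: "frag.span (full_seed ` labels) = quiver_lattice G d"
proof
  have gen: "x_gen i m \<in> frag.span (frag_of ` gens G d)" "p_gen i m \<in> frag.span (frag_of ` gens G d)"
    if "i \<in> verts G" "1 \<le> m" "m \<le> d i" for i m
    using that by (auto simp: x_gen_def p_gen_def gens_def intro!: frag.span_base imageI)
  have "seed_vector G d k \<in> frag.span (frag_of ` gens G d)" if "k \<in> mutable_labels G d" for k
    using that weight_pos unfolding mutable_labels_def
    by (auto intro!: frag.span_add frag.span_diff gen)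
  moreover have "completing_vector k \<in> frag.span (frag_of ` gens G d)" if "k \<in> frozen_labels G" for k
    using that weight_pos root unfolding frozen_labels_def
    by (auto intro!: gen)
  ultimately show "frag.span (full_seed ` labels) \<subseteq> quiver_lattice G d"
    unfolding quiver_lattice_span
    by (intro frag.span_minimal frag.subspace_span) auto
  have "p_gen r 1 \<in> frag.span (full_seed ` labels)"
    by (intro frag.span_base image_eqI[of _ _ "Inr Bullet"]) (auto simp: frozen_labels_def)
  then have "p_gen i m \<in> frag.span (full_seed ` labels)" if "i \<in> verts G" "1 \<le> m" "m \<le> d i" for i m
    using p_gen_in_full_span_iff[OF that] walk_from_root[OF that(1)] p_gen_along_walk by metis
  then have "frag_of ` gens G d \<subseteq> frag.span (full_seed ` labels)"
    using x_gen_in_full_span by (auto simp: gens_def p_gen_def x_gen_def)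
  then show "quiver_lattice G d \<subseteq> frag.span (full_seed ` labels)"
    unfolding quiver_lattice_span by (rule frag.span_minimal) (rule frag.subspace_span)
qed

lemma subtree_sum_in_lattice:
  assumes "i \<in> verts G"
  shows "subtree_sum G r d i \<in> quiver_lattice G d"
proof -
  have "x_varpi j (d j) \<in> quiver_lattice G d" if "j \<in> descendants_eq G r i" for j
    using that descendants_eq_subset[OF assms] by (intro x_varpi_in_lattice) auto
  then show ?thesis
    unfolding subtree_sum_def quiver_lattice_span by (intro frag.span_sum)
qed

lemma full_dual_in_lattice:
  assumes "k \<in> labels"
  shows "full_dual k \<in> quiver_lattice G d"
proof -
  note x = x_varpi_in_lattice[where G = G and d = d, unfolded quiver_lattice_span]
    and p = p_varpi_in_lattice[where G = G and d = d, unfolded quiver_lattice_span]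
  have arrow: "dual_vector G r d (A a) \<in> frag.span (frag_of ` gens G d)" if "a \<in> arcs G" for a
    using subtree_sum_in_lattice that unfolding quiver_lattice_span
    by (auto intro: frag.span_neg)
  have rho: "rho G r d i \<in> frag.span (frag_of ` gens G d)" if "i \<in> verts G" for i
    unfolding rho_eq using x arrow that
    by (auto intro!: frag.span_diff frag.span_sum simp del: dual_vector.simps)
  show ?thesis
  proof (cases k)
    case (Inl l)
    then show ?thesis
      using assms rho x p arrow unfolding quiver_lattice_span
      by (auto simp: mutable_labels_def intro!: frag.span_add frag.span_diff simp del: dual_vector.simps(3))
  next
    case (Inr l)
    then show ?thesis
      using assms x p unfolding quiver_lattice_span
      by (auto simp: frozen_labels_def intro!: frag.span_neg frag.span_sum)
  qed
qed

lemma full_seed_basis: "inj_on full_seed labels" "Z_basis (quiver_lattice G d) (full_seed ` labels)"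
proof -
  have tri: "skew_form (full_seed j) (full_dual i) = (if i = j then 1 else 0)"
    if "i \<in> labels" "j \<in> labels" "(if isl i then 1 else 0) \<le> (if isl j then 1 else 0 :: nat)" for i j
    using full_pairing[of j i] that by (auto split: if_splits)
  show "inj_on full_seed labels"
    by (rule unitriangular_inj[OF skew_form_hom_left tri])
  have "frag.independent (full_seed ` labels)"
    by (rule unitriangular_independent[OF skew_form_hom_left tri])
  then show "Z_basis (quiver_lattice G d) (full_seed ` labels)"
    by (simp add: Z_basis_def full_seed_span)
qed

lemma full_dual_basis: "inj_on full_dual labels" "Z_basis (quiver_lattice G d) (full_dual ` labels)"
proof -
  have tri: "skew_form (full_seed i) (full_dual j) = (if i = j then 1 else 0)"
    if "i \<in> labels" "j \<in> labels" "(if isl i then 0 else 1) \<le> (if isl j then 0 else 1 :: nat)" for i j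
    using full_pairing[of i j] that by (auto split: if_splits)
  show "inj_on full_dual labels"
    by (rule unitriangular_inj[OF skew_form_hom_right tri])
  have "frag.independent (full_dual ` labels)"
    by (rule unitriangular_independent[OF skew_form_hom_right tri])
  moreover have "frag.span (full_dual ` labels) = quiver_lattice G d"
    by (rule unitriangular_span[OF skew_form_hom_right skew_form_hom_left
          skew_form_nondegenerate finite_labels full_seed_span _ tri])
       (use full_dual_in_lattice in auto)
  ultimately show "Z_basis (quiver_lattice G d) (full_dual ` labels)"
    by (simp add: Z_basis_def)
qed

end

theorem proposition7p1:
  fixes G :: "('v,'a) pre_digraph" and r :: 'v and d :: "'v \<Rightarrow> nat"
    and ms :: "('v,'a) mutable_label list" and fs :: "'v frozen_label list"
  assumes "fin_digraph G"
    and "underlying_tree G"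
    and "r \<in> verts G"
    and "\<And>i. i \<in> verts G \<Longrightarrow> d i \<ge> 1"
    and "distinct ms" and "set ms = mutable_labels G d"
    and "distinct fs" and "set fs = frozen_labels G"
  shows "compatible_pair (quiver_lattice G d) skew_form (quiver_seed G d)
           (map (dual_vector G r d) ms @ map (frozen_vector G d) fs) \<and>
         dual_orderings skew_form (map (seed_vector G d) ms)
           (map (dual_vector G r d) ms @ map (frozen_vector G d) fs)"
proof -
  interpret fin_digraph G by fact
  interpret weighted_rooted_tree G r d
    using assms(2-4) by unfold_locales
  let ?es = "map (seed_vector G d) ms"
  let ?xs = "map (dual_vector G r d) ms @ map (frozen_vector G d) fs"
  let ?ls = "map Inl ms @ map Inr fs"
  have ls: "set ?ls = labels" "distinct ?ls"
    using assms(5-8) by (auto simp: distinct_map)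
  have xs: "?xs = map full_dual ?ls"
    by simp
  have "ordered_Z_basis (quiver_lattice G d) ?xs"
    unfolding ordered_Z_basis_def xs using full_dual_basis ls by (simp only: distinct_map set_map simp_thms)
  moreover have "quiver_seed G d = full_seed ` Inl ` mutable_labels G d"
    by (simp add: quiver_seed_def image_image)
  then have "quiver_seed G d \<subseteq> full_seed ` labels"
    by auto
  then have "cluster_seed (quiver_lattice G d) (quiver_seed G d)"
    unfolding cluster_seed_def using full_seed_basis(2) finite_labels finite_subset by blast
  moreover have "distinct ?es"
  proof -
    have "distinct (map full_seed (map Inl ms))"
      using full_seed_basis(1) ls by (subst distinct_map) (auto intro: inj_on_subset)
    then show ?thesis by (simp add: comp_def)
  qed
  moreover have "set ?es = quiver_seed G d"
    using assms(6) by (simp add: quiver_seed_def)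
  moreover have "dual_orderings skew_form ?es ?xs"
    unfolding dual_orderings_def
  proof (intro allI impI)
    fix i j assume i: "i < length ?es" and j: "j < length ?xs"
    have "?es ! i = full_seed (?ls ! i)" "isl (?ls ! i)" "?xs ! j = full_dual (?ls ! j)"
      using i j by (auto simp: nth_append)
    moreover have "?ls ! i \<in> labels" "?ls ! j \<in> labels"
      using i j ls(1) nth_mem[of _ ?ls] by auto
    moreover have "?ls ! i = ?ls ! j \<longleftrightarrow> i = j"
      using ls(2) i j nth_eq_iff_index_eq[of ?ls i j] by auto
    ultimately show "skew_form (?es ! i) (?xs ! j) = (if i = j then 1 else 0)"
      using full_pairing by simp
  qed
  ultimately show ?thesis
    unfolding compatible_pair_def by blast
qed

end
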